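(* In the codimension-one setting described in the context, let $\beta\in V_{\mathbb{C}}$. The set $E'_\beta$ is a singleton if and only if the following two conditions are satisfied: (a) $\beta\in\sum_{i=1}^k(\mathbb{Z}_{\ge0})\mathbf{a}_i+\sum_{j=k+1}^n\mathbb{C}\mathbf{a}_j$, (b) $\ell_i=1$ for $i=1,\dots,k$.
   Context: Setting: $A=\{\mathbf{a}_1,\dots,\mathbf{a}_n\}\subseteq\mathbb{Z}^d$, $V\subseteq\mathbb{R}^d$ is the real span of $A$ and $V_{\mathbb{C}}\subseteq\mathbb{C}^d$ its complex span. It is assumed that $\dim V=n-1$ and that each subset of $A$ of cardinality $n-1$ is linearly independent. The lattice of integer relations on $A$ is generated by a single relation $\sum_{i=1}^k \ell_i\mathbf{a}_i-\sum_{j=k+1}^n\ell_j\mathbf{a}_j=\mathbf{0}$, where $1\le k\le n$ and $\ell_1,\dots,\ell_n$ are relatively prime positive integers. For $\beta\in V_{\mathbb{C}}$, $i\in\{1,\dots,k\}$ and $b\in\{0,1,\dots,\ell_i-1\}$, let $v^{(i,b)}\in\mathbb{C}^n$ be the unique vector with $v^{(i,b)}_i=b$ and $\sum_{\mu=1}^n v^{(i,b)}_\mu\mathbf{a}_\mu=\beta$. Put $E_\beta=\{v^{(i,b)}\mid 1\le i\le k,\ 0\le b\le \ell_i-1\}$ and $E'_\beta=\{v\in E_\beta\mid v_i\notin\mathbb{Z}_{<0}\text{ for }i=1,\dots,k\}$. *)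

theory Defs
  imports "HOL-Analysis.Analysis"
begin

definition vec_of_int :: "int ^ 'd \<Rightarrow> 'a::ring_1 ^ 'd" where
  "vec_of_int x = (\<chi> i. of_int (x $ i))"

text \<open>The vectors are \<open>a 1, \<dots>, a n\<close>; a point of \<open>\<complex>\<^sup>n\<close> is a function in
  \<open>{1..n} \<rightarrow>\<^sub>E UNIV\<close>, i.e. one whose values outside \<open>{1..n}\<close> are fixed, so that vectors
  agreeing on \<open>{1..n}\<close> are equal.\<close>

definition exponent_vec ::
    "nat \<Rightarrow> (nat \<Rightarrow> int ^ 'd) \<Rightarrow> complex ^ 'd \<Rightarrow> nat \<Rightarrow> nat \<Rightarrow> (nat \<Rightarrow> complex)" where
  "exponent_vec n a \<beta> i b =
     (THE v. v \<in> {1..n} \<rightarrow>\<^sub>E UNIV \<and> v i = of_nat b \<and>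
             (\<Sum>\<mu>=1..n. v \<mu> *s vec_of_int (a \<mu>)) = \<beta>)"

definition exponent_set ::
    "nat \<Rightarrow> nat \<Rightarrow> (nat \<Rightarrow> int ^ 'd) \<Rightarrow> (nat \<Rightarrow> nat) \<Rightarrow> complex ^ 'd \<Rightarrow> (nat \<Rightarrow> complex) set" where
  "exponent_set n k a l \<beta> = {exponent_vec n a \<beta> i b | i b. i \<in> {1..k} \<and> b \<in> {0..<l i}}"

definition exponent_set' ::
    "nat \<Rightarrow> nat \<Rightarrow> (nat \<Rightarrow> int ^ 'd) \<Rightarrow> (nat \<Rightarrow> nat) \<Rightarrow> complex ^ 'd \<Rightarrow> (nat \<Rightarrow> complex) set" where
  "exponent_set' n k a l \<beta> =
     {v \<in> exponent_set n k a l \<beta>. \<forall>i\<in>{1..k}. v i \<notin> of_int ` {..<0}}"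

end

theory Submission
  imports Defs
begin

text \<open>
  The vectors \<open>v\<close> with \<open>\<Sum>\<mu>. v \<mu> *s a \<mu> = \<beta>\<close> form a complex line \<open>w + t \<rho>\<close>, where
  \<open>\<rho> = (l 1, \<dots>, l k, - l (k+1), \<dots>, - l n)\<close> is the given relation: the dimension of \<open>V\<close> leaves
  room for only one relation up to scaling. So \<open>E\<^sub>\<beta>\<close> and \<open>E'\<^sub>\<beta>\<close> can be
  described by sets of parameters \<open>t\<close>.

  Moving \<open>t\<close> by an integer does not change which of the coordinates \<open>w i + t l i\<close>, \<open>i \<le> k\<close>, are
  integers. In a class of \<open>t\<close> modulo \<open>\<int>\<close> in which at least one of them is an integer, there is a
  lowest \<open>t\<close> at which all these integers are nonnegative. One step below, some coordinate turns
  negative, so at the lowest \<open>t\<close> that coordinate lies in \<open>{0, \<dots>, l i - 1}\<close>; this says that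
  the point is in \<open>E'\<^sub>\<beta>\<close>. Hence each such class contributes exactly one point to \<open>E'\<^sub>\<beta>\<close>
  (\<open>ex_int_shift_reduced\<close>, \<open>reduced_eqI\<close>), and \<open>E'\<^sub>\<beta>\<close> is a singleton iff there is
  just one class.

  The coordinate \<open>i\<close> alone is an integer on \<open>l i\<close> different classes, so having a single class forces
  \<open>l i = 1\<close> for all \<open>i \<le> k\<close>, and it makes all the first \<open>k\<close> coordinates of the unique point
  nonnegative integers, which is condition (a). Conversely, if \<open>l i = 1\<close> for \<open>i \<le> k\<close>, and \<open>w\<close> is
  the coefficient vector provided by (a), then an integral coordinate forces \<open>t\<close> to be an integer.
\<close>

section \<open>Relations between the vectors\<close>

text \<open>
  Because \<open>\<rho> i \<noteq> 0\<close>, the vector \<open>x i\<close> can be dropped without changing the span. The remaining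
  \<open>card I - 1\<close> vectors span a space of that dimension, so they are distinct and independent.
\<close>

lemma relation_eq_zero_real:
  fixes x :: "'i \<Rightarrow> 'v :: euclidean_space" and r \<rho> :: "'i \<Rightarrow> real"
  assumes I: "finite I" "i \<in> I" "j \<in> I"
    and dim: "dim (span (x ` I)) = card I - 1"
    and \<rho>: "(\<Sum>\<mu>\<in>I. \<rho> \<mu> *\<^sub>R x \<mu>) = 0" "\<rho> i \<noteq> 0"
    and r: "(\<Sum>\<mu>\<in>I. r \<mu> *\<^sub>R x \<mu>) = 0" "r i = 0"
  shows "r j = 0"
proof -
  let ?J = "I - {i}"
  have "\<rho> i *\<^sub>R x i = - (\<Sum>\<mu>\<in>?J. \<rho> \<mu> *\<^sub>R x \<mu>)"
    using \<rho>(1) I by (simp add: sum.remove[OF I(1,2)] eq_neg_iff_add_eq_0)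
  also have "\<dots> \<in> span (x ` ?J)"
    by (intro span_neg span_sum span_scale span_base) auto
  finally have "x i \<in> span (x ` ?J)"
    using \<rho>(2) by (metis span_scale scaleR_scaleR left_inverse scaleR_one)
  hence span: "x ` I \<subseteq> span (x ` ?J)"
    by (auto intro: span_base)
  hence dim_J: "dim (x ` ?J) = card ?J"
    using dim I span_minimal[OF span subspace_span] span_mono[of "x ` ?J" "x ` I"]
    by (metis Diff_subset card_Diff_singleton dim_span image_mono subset_antisym)
  have card_le: "card (x ` ?J) \<le> card ?J"
    using I by (intro card_image_le) auto
  have "card ?J \<le> card (x ` ?J)"
    using dim_le_card'[of "x ` ?J"] dim_J I by simp
  with card_le have card: "card (x ` ?J) = card ?J" by simp
  hence inj: "inj_on x ?J"
    using I by (intro eq_card_imp_inj_on) auto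
  have indep: "independent (x ` ?J)"
    by (rule card_le_dim_spanning[of _ "x ` ?J"]) (use I card dim_J in \<open>auto intro: span_base\<close>)
  have "(\<Sum>\<mu>\<in>?J. r \<mu> *\<^sub>R x \<mu>) = 0"
    using r I by (simp add: sum.remove[OF I(1,2)])
  hence sum0: "(\<Sum>y\<in>x ` ?J. r (the_inv_into ?J x y) *\<^sub>R y) = 0"
    by (simp add: sum.reindex[OF inj] the_inv_into_f_f[OF inj])
  show ?thesis
  proof (cases "j = i")
    case False
    hence "r (the_inv_into ?J x (x j)) = 0"
      using independentD[OF indep _ subset_refl sum0] I by auto
    thus ?thesis using False I by (simp add: the_inv_into_f_f[OF inj])
  qed (use r in simp)
qed

text \<open>The vectors are real, so the real and imaginary parts of a complex relation are real relations.\<close>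

lemma relation_eq_zero_complex:
  fixes a :: "'i \<Rightarrow> int ^ 'd" and v :: "'i \<Rightarrow> complex" and \<rho> :: "'i \<Rightarrow> int"
  assumes I: "finite I" "i \<in> I" "j \<in> I"
    and dim: "dim (span (vec_of_int ` a ` I :: (real ^ 'd) set)) = card I - 1"
    and \<rho>: "(\<Sum>\<mu>\<in>I. \<rho> \<mu> *s a \<mu>) = 0" "\<rho> i \<noteq> 0"
    and v: "(\<Sum>\<mu>\<in>I. v \<mu> *s vec_of_int (a \<mu>)) = 0" "v i = 0"
  shows "v j = 0"
proof -
  let ?x = "\<lambda>\<mu>. vec_of_int (a \<mu>) :: real ^ 'd"
  have dim': "dim (span (?x ` I)) = card I - 1"
    using dim by (simp add: image_image)
  have comp: "(\<Sum>\<mu>\<in>I. v \<mu> * of_int (a \<mu> $ s)) = 0" for s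
    using arg_cong[OF v(1), of "\<lambda>z. z $ s"] by (simp add: vec_of_int_def)
  have "(\<Sum>\<mu>\<in>I. \<rho> \<mu> * a \<mu> $ s) = 0" for s
    using arg_cong[OF \<rho>(1), of "\<lambda>z. z $ s"] by simp
  hence "(\<Sum>\<mu>\<in>I. of_int (\<rho> \<mu>) * of_int (a \<mu> $ s)) = (0::real)" for s
    by (metis (mono_tags, lifting) of_int_0 of_int_mult of_int_sum sum.cong)
  hence \<rho>_real: "(\<Sum>\<mu>\<in>I. of_int (\<rho> \<mu>) *\<^sub>R ?x \<mu>) = 0"
    by (simp add: vec_eq_iff vec_of_int_def)
  have "(\<Sum>\<mu>\<in>I. Re (v \<mu>) *\<^sub>R ?x \<mu>) = 0"
    using arg_cong[OF comp, of Re] by (simp add: vec_eq_iff vec_of_int_def)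
  hence "Re (v j) = 0"
    using relation_eq_zero_real[OF I dim' \<rho>_real, of "\<lambda>\<mu>. Re (v \<mu>)"] \<rho> v by simp
  moreover have "(\<Sum>\<mu>\<in>I. Im (v \<mu>) *\<^sub>R ?x \<mu>) = 0"
    using arg_cong[OF comp, of Im] by (simp add: vec_eq_iff vec_of_int_def)
  hence "Im (v j) = 0"
    using relation_eq_zero_real[OF I dim' \<rho>_real, of "\<lambda>\<mu>. Im (v \<mu>)"] \<rho> v by simp
  ultimately show ?thesis by (simp add: complex_eq_iff)
qed

lemma in_vec_span_imageE:
  fixes x :: "'i \<Rightarrow> 'a :: field ^ 'd"
  assumes "y \<in> vec.span (x ` I)" "finite I"
  obtains w where "(\<Sum>\<mu>\<in>I. w \<mu> *s x \<mu>) = y"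
proof -
  from assms(1) have "\<exists>w. (\<Sum>\<mu>\<in>I. w \<mu> *s x \<mu>) = y"
  proof (induction rule: vec.span_induct_alt)
    case base
    show ?case by (rule exI[of _ "\<lambda>_. 0"]) simp
  next
    case (step c z y)
    then obtain w i where w: "(\<Sum>\<mu>\<in>I. w \<mu> *s x \<mu>) = y" and i: "i \<in> I" "z = x i" by auto
    have "(\<Sum>\<mu>\<in>I. (w(i := w i + c)) \<mu> *s x \<mu>) =
          (w i + c) *s x i + (\<Sum>\<mu>\<in>I - {i}. w \<mu> *s x \<mu>)"
      using assms(2) i by (simp add: sum.remove[of I i])
    also have "\<dots> = c *s z + (\<Sum>\<mu>\<in>I. w \<mu> *s x \<mu>)"
      using assms(2) i by (simp add: sum.remove[of I i] vector_sadd_rdistrib)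
    finally show ?case using w by blast
  qed
  thus ?thesis using that by blast
qed

section \<open>The line of solutions\<close>

definition line :: "'i set \<Rightarrow> ('i \<Rightarrow> complex) \<Rightarrow> ('i \<Rightarrow> int) \<Rightarrow> complex \<Rightarrow> 'i \<Rightarrow> complex" where
  "line I w \<rho> t = (\<lambda>\<mu>\<in>I. w \<mu> + t * of_int (\<rho> \<mu>))"

lemma line_eq_iff:
  assumes "i \<in> I" "\<rho> i \<noteq> 0"
  shows "line I w \<rho> s = line I w \<rho> t \<longleftrightarrow> s = t"
proof
  assume "line I w \<rho> s = line I w \<rho> t"
  from fun_cong[OF this, of i] assms show "s = t" by (simp add: line_def)
qed simp

lemma sum_line:
  fixes a :: "'i \<Rightarrow> int ^ 'd"
  assumes "(\<Sum>\<mu>\<in>I. \<rho> \<mu> *s a \<mu>) = 0"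
  shows "(\<Sum>\<mu>\<in>I. line I w \<rho> t \<mu> *s vec_of_int (a \<mu>)) = (\<Sum>\<mu>\<in>I. w \<mu> *s vec_of_int (a \<mu>))"
proof -
  have "(\<Sum>\<mu>\<in>I. \<rho> \<mu> * a \<mu> $ s) = 0" for s
    using arg_cong[OF assms, of "\<lambda>z. z $ s"] by simp
  hence "(\<Sum>\<mu>\<in>I. of_int (\<rho> \<mu>) * of_int (a \<mu> $ s)) = (0::complex)" for s
    by (metis (mono_tags, lifting) of_int_0 of_int_mult of_int_sum sum.cong)
  hence "(\<Sum>\<mu>\<in>I. t * of_int (\<rho> \<mu>) * of_int (a \<mu> $ s)) = (0::complex)" for s
    by (simp add: mult.assoc flip: sum_distrib_left)
  thus ?thesis
    by (simp add: vec_eq_iff line_def vec_of_int_def distrib_right sum.distrib)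
qed

text \<open>
  Two solutions that agree in coordinate \<open>i\<close> differ by a relation that vanishes at \<open>i\<close>, so they are
  equal. This identifies the definite description with the point of the line where coordinate
  \<open>i\<close> is \<open>b\<close>.
\<close>

lemma exponent_vec_eq_line:
  fixes a :: "nat \<Rightarrow> int ^ 'd"
  assumes i: "i \<in> {1..n}"
    and dim: "dim (span (vec_of_int ` a ` {1..n} :: (real ^ 'd) set)) = n - 1"
    and \<rho>: "(\<Sum>\<mu>=1..n. \<rho> \<mu> *s a \<mu>) = 0" "\<rho> i \<noteq> 0"
    and w: "(\<Sum>\<mu>=1..n. w \<mu> *s vec_of_int (a \<mu>)) = \<beta>"
  shows "exponent_vec n a \<beta> i b = line {1..n} w \<rho> ((of_nat b - w i) / of_int (\<rho> i))"
  unfolding exponent_vec_def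
proof (rule the_equality, intro conjI)
  let ?p = "line {1..n} w \<rho> ((of_nat b - w i) / of_int (\<rho> i))"
  show p: "?p \<in> {1..n} \<rightarrow>\<^sub>E UNIV" by (simp add: line_def)
  show p_i: "?p i = of_nat b" using i \<rho>(2) by (simp add: line_def)
  show p_sum: "(\<Sum>\<mu>=1..n. ?p \<mu> *s vec_of_int (a \<mu>)) = \<beta>"
    using sum_line[OF \<rho>(1)] w by simp
  fix v :: "nat \<Rightarrow> complex"
  assume v: "v \<in> {1..n} \<rightarrow>\<^sub>E UNIV \<and> v i = of_nat b \<and>
             (\<Sum>\<mu>=1..n. v \<mu> *s vec_of_int (a \<mu>)) = \<beta>"
  have "(\<Sum>\<mu>=1..n. (v \<mu> - ?p \<mu>) *s vec_of_int (a \<mu>)) = 0"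
    using v p_sum by (simp add: vector_sub_rdistrib sum_subtractf)
  hence "v j - ?p j = 0" if "j \<in> {1..n}" for j
    using relation_eq_zero_complex[OF _ i that _ \<rho>, of "\<lambda>\<mu>. v \<mu> - ?p \<mu>"] v p_i dim by simp
  thus "v = ?p" using v p by (intro PiE_ext[of v "{1..n}" "\<lambda>_. UNIV"]) auto
qed

section \<open>Reduced parameters\<close>

text \<open>The parameters \<open>t\<close> of the points of \<open>E'\<^sub>\<beta>\<close> on the line \<open>w + t \<rho>\<close>.\<close>

definition reduced :: "'i set \<Rightarrow> ('i \<Rightarrow> nat) \<Rightarrow> ('i \<Rightarrow> complex) \<Rightarrow> complex set" where
  "reduced K l w = {t. (\<exists>i\<in>K. \<exists>b<l i. w i + t * of_nat (l i) = of_nat b) \<and>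
                       (\<forall>i\<in>K. w i + t * of_nat (l i) \<notin> of_int ` {..<0})}"

text \<open>
  Write \<open>z j\<close> for those coordinates that are integers. The shift \<open>m\<close> makes \<open>z j + m l j\<close>
  nonnegative iff \<open>m \<ge> - (z j div l j)\<close>, and for equality the result is the remainder
  \<open>z j mod l j\<close>. So the least common \<open>m\<close> is the maximum of these bounds.
\<close>

lemma ex_int_shift_reduced:
  fixes w :: "'i \<Rightarrow> complex"
  assumes K: "finite K" "i \<in> K" "\<And>j. j \<in> K \<Longrightarrow> 0 < l j"
    and int: "w i + t * of_nat (l i) \<in> \<int>"
  shows "\<exists>m::int. t + of_int m \<in> reduced K l w"
proof -
  define J where "J = {j\<in>K. w j + t * of_nat (l j) \<in> \<int>}"
  have "\<forall>j\<in>J. \<exists>z. w j + t * of_nat (l j) = of_int z"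
    by (auto simp: J_def elim: Ints_cases)
  then obtain z :: "'i \<Rightarrow> int" where z: "\<And>j. j \<in> J \<Longrightarrow> w j + t * of_nat (l j) = of_int (z j)"
    by metis
  define B where "B = (\<lambda>j. - (z j div int (l j))) ` J"
  define m where "m = Max B"
  have B: "finite B" "B \<noteq> {}"
    using K int by (auto simp: B_def J_def)
  have shift: "w j + (t + of_int m) * of_nat (l j) = of_int (z j + m * int (l j))" if "j \<in> J" for j
    using z[OF that] by (simp add: algebra_simps)
  have nonneg: "z j + m * int (l j) \<ge> 0" if "j \<in> J" for j
  proof -
    have "- (z j div int (l j)) \<le> m"
      unfolding m_def using B that by (intro Max_ge) (auto simp: B_def)
    hence "- (z j div int (l j)) * int (l j) \<le> m * int (l j)"
      by (rule mult_right_mono) simp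
    moreover have "z j mod int (l j) \<ge> 0"
      using K that by (auto simp: J_def)
    ultimately show ?thesis
      using div_mult_mod_eq[of "z j" "int (l j)"] by linarith
  qed
  have "m \<in> B" unfolding m_def using B by (rule Max_in)
  then obtain s where s: "s \<in> J" "m = - (z s div int (l s))" by (auto simp: B_def)
  have "z s + m * int (l s) = z s mod int (l s)"
    by (simp add: s(2) minus_div_mult_eq_mod)
  hence "w s + (t + of_int m) * of_nat (l s) = of_int (z s mod int (l s))"
    using shift[OF s(1)] by simp
  moreover have "z s mod int (l s) \<ge> 0" "z s mod int (l s) < int (l s)"
    using K s by (auto simp: J_def)
  ultimately have "nat (z s mod int (l s)) < l s"
      "w s + (t + of_int m) * of_nat (l s) = of_nat (nat (z s mod int (l s)))"
    by (auto simp: nat_less_iff)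
  moreover have "s \<in> K" using s by (simp add: J_def)
  moreover have "w j + (t + of_int m) * of_nat (l j) \<notin> of_int ` {..<0}" if j: "j \<in> K" for j
  proof
    assume "w j + (t + of_int m) * of_nat (l j) \<in> of_int ` {..<0}"
    then obtain q :: int where q: "q < 0" "w j + (t + of_int m) * of_nat (l j) = of_int q" by auto
    hence "w j + t * of_nat (l j) = of_int (q - m * int (l j))"
      by (simp add: algebra_simps)
    hence "j \<in> J" using j by (simp add: J_def)
    with shift[OF this] nonneg[OF this] q show False
      by (metis of_int_eq_iff linorder_not_less)
  qed
  ultimately show ?thesis unfolding reduced_def by blast
qed

text \<open>
  At \<open>s\<close> some coordinate \<open>i\<close> has a value in \<open>{0, \<dots>, l i - 1}\<close>, and each integer step down lowers
  it by \<open>l i\<close>. So no point at a positive integer distance below \<open>s\<close> is reduced.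
\<close>

lemma reduced_not_below:
  assumes "s \<in> reduced K l w" "t \<in> reduced K l w" "s = t + of_int m"
  shows "m \<le> 0"
proof (rule ccontr)
  assume "\<not> m \<le> 0"
  from assms(1) obtain i b where i: "i \<in> K" "b < l i" "w i + s * of_nat (l i) = of_nat b"
    by (auto simp: reduced_def)
  have "1 * int (l i) \<le> m * int (l i)"
    using \<open>\<not> m \<le> 0\<close> by (intro mult_right_mono) auto
  hence neg: "int b - m * int (l i) < 0" using i(2) by linarith
  have "w i + t * of_nat (l i) = of_int (int b - m * int (l i))"
    using i(3) assms(3) by (simp add: algebra_simps)
  hence "w i + t * of_nat (l i) \<in> of_int ` {..<0}" using neg by blast
  with assms(2) i(1) show False by (auto simp: reduced_def)
qed

lemma reduced_eqI:
  assumes "s \<in> reduced K l w" "t \<in> reduced K l w" "s - t \<in> \<int>"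
  shows "s = t"
proof -
  obtain m where m: "s - t = of_int m" using assms(3) by (elim Ints_cases)
  have "m \<le> 0" "- m \<le> 0"
    using reduced_not_below[OF assms(1,2), of m] reduced_not_below[OF assms(2,1), of "- m"] m
    by (auto simp: algebra_simps)
  thus ?thesis using m by simp
qed

lemma is_singleton_reducedD:
  fixes w :: "'i \<Rightarrow> complex"
  assumes K: "finite K" "\<And>j. j \<in> K \<Longrightarrow> 0 < l j"
    and single: "reduced K l w = {t}" and i: "i \<in> K"
  shows "l i = 1" and "w i + t * of_nat (l i) \<in> \<nat>"
proof -
  have l_i: "l i > 0" using K i by simp
  have cong: "\<exists>m. (of_int c - w i) / of_nat (l i) + of_int m = t" for c :: int
    using ex_int_shift_reduced[of K i l w "(of_int c - w i) / of_nat (l i)"] K i single l_i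
    by simp
  obtain m where m: "(of_int 0 - w i) / of_nat (l i) + of_int m = t" using cong by blast
  obtain m' where m': "(of_int 1 - w i) / of_nat (l i) + of_int m' = t" using cong by blast
  \<comment> \<open>The coordinate takes the values \<open>0\<close> and \<open>1\<close> at parameters that differ by \<open>1 / l i\<close>, and
    this difference must be an integer.\<close>
  have "(1 :: complex) = of_int ((m - m') * int (l i))"
    using m m' l_i by (simp add: field_simps)
  hence "1 = (m - m') * int (l i)" by (metis of_int_1 of_int_eq_iff)
  thus "l i = 1" by (metis dvd_triv_right int_dvd_int_iff nat_dvd_1_iff_1 of_nat_1)
  have "w i + t * of_nat (l i) = of_int (m * int (l i))"
    using m l_i by (simp add: field_simps)
  moreover have "w i + t * of_nat (l i) \<notin> of_int ` {..<0}"
    using single i by (auto simp: reduced_def)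
  ultimately have "\<not> m * int (l i) < 0" by (metis image_eqI lessThan_iff)
  thus "w i + t * of_nat (l i) \<in> \<nat>"
    using \<open>w i + t * of_nat (l i) = of_int (m * int (l i))\<close>
    by (metis linorder_not_less of_int_of_nat_eq of_nat_in_Nats zero_le_imp_eq_int)
qed

lemma is_singleton_reducedI:
  assumes "finite K" "K \<noteq> {}" and l: "\<And>i. i \<in> K \<Longrightarrow> l i = 1" and w: "\<And>i. i \<in> K \<Longrightarrow> w i \<in> \<int>"
  shows "is_singleton (reduced K l w)"
proof (rule is_singletonI')
  obtain i where "i \<in> K" using assms(2) by blast
  thus "reduced K l w \<noteq> {}"
    using ex_int_shift_reduced[OF assms(1), of i l w 0] l w by auto
  have int: "t \<in> \<int>" if "t \<in> reduced K l w" for t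
  proof -
    obtain i b where i: "i \<in> K" "b < l i" "w i + t * of_nat (l i) = of_nat b"
      using \<open>t \<in> reduced K l w\<close> by (auto simp: reduced_def)
    hence "w i + t = 0" using l[OF i(1)] by simp
    thus ?thesis using w[OF i(1)] by (metis Ints_minus add.commute eq_neg_iff_add_eq_0)
  qed
  show "s = t" if "s \<in> reduced K l w" "t \<in> reduced K l w" for s t
    using reduced_eqI[OF that] int that by simp
qed

section \<open>The exponent set as a set of reduced parameters\<close>

lemma exponent_set'_eq_line_image:
  fixes a :: "nat \<Rightarrow> int ^ 'd"
  assumes "k \<le> n" and l: "\<And>i. i \<in> {1..k} \<Longrightarrow> 0 < l i"
    and dim: "dim (span (vec_of_int ` a ` {1..n} :: (real ^ 'd) set)) = n - 1"
    and \<rho>: "(\<Sum>\<mu>=1..n. \<rho> \<mu> *s a \<mu>) = 0" "\<And>i. i \<in> {1..k} \<Longrightarrow> \<rho> i = int (l i)"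
    and w: "(\<Sum>\<mu>=1..n. w \<mu> *s vec_of_int (a \<mu>)) = \<beta>"
  shows "exponent_set' n k a l \<beta> = line {1..n} w \<rho> ` reduced {1..k} l w"
proof -
  have "exponent_vec n a \<beta> i b = line {1..n} w \<rho> ((of_nat b - w i) / of_nat (l i))"
    if "i \<in> {1..k}" for i b
    using exponent_vec_eq_line[OF _ dim \<rho>(1) _ w, of i b] that l[OF that] \<rho>(2)[OF that] \<open>k \<le> n\<close>
    by simp
  hence "exponent_set n k a l \<beta> = {line {1..n} w \<rho> ((of_nat b - w i) / of_nat (l i)) | i b.
      i \<in> {1..k} \<and> b < l i}"
    unfolding exponent_set_def by (intro Collect_cong ex_cong1) auto
  also have "\<dots> = line {1..n} w \<rho> ` {t. \<exists>i\<in>{1..k}. \<exists>b<l i. w i + t * of_nat (l i) = of_nat b}"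
  proof -
    have "w i + t * of_nat (l i) = of_nat b \<longleftrightarrow> t = (of_nat b - w i) / of_nat (l i)"
      if "i \<in> {1..k}" for i b t
      using l[OF that] by (auto simp: field_simps)
    hence "{t. \<exists>i\<in>{1..k}. \<exists>b<l i. w i + t * of_nat (l i) = of_nat b} =
        {(of_nat b - w i) / of_nat (l i) | i b. i \<in> {1..k} \<and> b < l i}" by blast
    thus ?thesis by auto
  qed
  finally have E: "exponent_set n k a l \<beta> =
      line {1..n} w \<rho> ` {t. \<exists>i\<in>{1..k}. \<exists>b<l i. w i + t * of_nat (l i) = of_nat b}" .
  have "line {1..n} w \<rho> t i = w i + t * of_nat (l i)" if "i \<in> {1..k}" for i t
    using that \<rho>(2)[OF that] \<open>k \<le> n\<close> by (simp add: line_def)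
  hence "reduced {1..k} l w =
      {t. (\<exists>i\<in>{1..k}. \<exists>b<l i. w i + t * of_nat (l i) = of_nat b) \<and>
          (\<forall>i\<in>{1..k}. line {1..n} w \<rho> t i \<notin> of_int ` {..<0})}"
    by (simp add: reduced_def)
  thus ?thesis unfolding exponent_set'_def E by blast
qed

theorem proposition9p2:
  fixes n k :: nat
    and a :: "nat \<Rightarrow> int ^ 'd"
    and l :: "nat \<Rightarrow> nat"
    and \<beta> :: "complex ^ 'd"
  assumes dim_V: "dim (span (vec_of_int ` a ` {1..n} :: (real ^ 'd) set)) = n - 1"
    and indep: "\<And>S. S \<subseteq> a ` {1..n} \<Longrightarrow> card S = n - 1 \<Longrightarrow>
                  independent (vec_of_int ` S :: (real ^ 'd) set)"
    and k: "1 \<le> k" "k \<le> n"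
    and l_pos: "\<And>i. i \<in> {1..n} \<Longrightarrow> 0 < l i"
    and l_coprime: "Gcd (l ` {1..n}) = 1"
    and relation: "(\<Sum>i=1..k. int (l i) *s a i) - (\<Sum>j=k+1..n. int (l j) *s a j) = 0"
    and generates: "\<And>u :: nat \<Rightarrow> int. (\<Sum>i=1..n. u i *s a i) = 0 \<Longrightarrow>
                  \<exists>c::int. (\<forall>i\<in>{1..k}. u i = c * int (l i)) \<and>
                           (\<forall>j\<in>{k+1..n}. u j = c * - int (l j))"
    and beta: "\<beta> \<in> vec.span (vec_of_int ` a ` {1..n})"
  shows "is_singleton (exponent_set' n k a l \<beta>) \<longleftrightarrow>
           \<beta> \<in> {(\<Sum>i=1..k. of_nat (m i) *s vec_of_int (a i)) +
                 (\<Sum>j=k+1..n. c j *s vec_of_int (a j))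
                 | (m :: nat \<Rightarrow> nat) (c :: nat \<Rightarrow> complex). True} \<and>
           (\<forall>i\<in>{1..k}. l i = 1)"
proof -
  define \<rho> where "\<rho> i = (if i \<le> k then int (l i) else - int (l i))" for i
  have split: "(\<Sum>\<mu>=1..n. f \<mu>) = (\<Sum>i=1..k. f i) + (\<Sum>j=k+1..n. f j)"
    for f :: "nat \<Rightarrow> 'b :: comm_monoid_add"
    using k sum.ub_add_nat[of 1 k f "n - k"] by simp
  have \<rho>_rel: "(\<Sum>\<mu>=1..n. \<rho> \<mu> *s a \<mu>) = 0"
    unfolding split using relation by (simp add: \<rho>_def sum_negf vector_smult_lneg)
  have \<rho>_pos: "\<rho> i = int (l i)" if "i \<in> {1..k}" for i
    using that by (simp add: \<rho>_def)
  have l: "0 < l i" if "i \<in> {1..k}" for i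
    using l_pos that k by simp
  have singleton_iff: "is_singleton (exponent_set' n k a l \<beta>) \<longleftrightarrow> is_singleton (reduced {1..k} l w)"
    if w: "(\<Sum>\<mu>=1..n. w \<mu> *s vec_of_int (a \<mu>)) = \<beta>" for w
  proof -
    have "inj_on (line {1..n} w \<rho>) (reduced {1..k} l w)"
      using line_eq_iff[of 1 "{1..n}" \<rho> w] k l[of 1] \<rho>_pos[of 1] by (auto intro: inj_onI)
    moreover have "exponent_set' n k a l \<beta> = line {1..n} w \<rho> ` reduced {1..k} l w"
      by (rule exponent_set'_eq_line_image) (use k l dim_V \<rho>_rel \<rho>_pos w in auto)
    ultimately have "card (exponent_set' n k a l \<beta>) = card (reduced {1..k} l w)"
      by (simp add: card_image)
    thus ?thesis by (simp add: is_singleton_altdef)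
  qed
  show ?thesis
  proof (intro iffI conjI ballI)
    assume single: "is_singleton (exponent_set' n k a l \<beta>)"
    from beta obtain w where w: "(\<Sum>\<mu>=1..n. w \<mu> *s vec_of_int (a \<mu>)) = \<beta>"
      by (auto simp: image_image elim: in_vec_span_imageE)
    obtain t where t: "reduced {1..k} l w = {t}"
      using single singleton_iff[OF w] by (auto simp: is_singleton_def)
    show "l i = 1" if "i \<in> {1..k}" for i
      using is_singleton_reducedD(1)[OF _ l t that] by simp
    let ?p = "line {1..n} w \<rho> t"
    have "\<forall>i\<in>{1..k}. \<exists>m::nat. ?p i = of_nat m"
      using is_singleton_reducedD(2)[OF _ l t] \<rho>_pos k by (fastforce simp: line_def elim: Nats_cases)
    then obtain m :: "nat \<Rightarrow> nat" where m: "\<And>i. i \<in> {1..k} \<Longrightarrow> ?p i = of_nat (m i)"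
      by metis
    have "\<beta> = (\<Sum>\<mu>=1..n. ?p \<mu> *s vec_of_int (a \<mu>))"
      using sum_line[OF \<rho>_rel] w by simp
    also have "\<dots> = (\<Sum>i=1..k. of_nat (m i) *s vec_of_int (a i)) +
                   (\<Sum>j=k+1..n. ?p j *s vec_of_int (a j))"
      unfolding split using m by simp
    finally show "\<beta> \<in> {(\<Sum>i=1..k. of_nat (m i) *s vec_of_int (a i)) +
                 (\<Sum>j=k+1..n. c j *s vec_of_int (a j))
                 | (m :: nat \<Rightarrow> nat) (c :: nat \<Rightarrow> complex). True}" by blast
  next
    assume "\<beta> \<in> {(\<Sum>i=1..k. of_nat (m i) *s vec_of_int (a i)) +
                 (\<Sum>j=k+1..n. c j *s vec_of_int (a j))
                 | (m :: nat \<Rightarrow> nat) (c :: nat \<Rightarrow> complex). True} \<and>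
           (\<forall>i\<in>{1..k}. l i = 1)"
    then obtain m :: "nat \<Rightarrow> nat" and c :: "nat \<Rightarrow> complex"
      where mc: "\<beta> = (\<Sum>i=1..k. of_nat (m i) *s vec_of_int (a i)) +
                 (\<Sum>j=k+1..n. c j *s vec_of_int (a j))"
        and l1: "\<And>i. i \<in> {1..k} \<Longrightarrow> l i = 1" by blast
    \<comment> \<open>Starting the line at this solution makes the first \<open>k\<close> coordinates integral at \<open>t = 0\<close>.\<close>
    define w where "w i = (if i \<le> k then of_nat (m i) else c i)" for i
    have w: "(\<Sum>\<mu>=1..n. w \<mu> *s vec_of_int (a \<mu>)) = \<beta>"
      unfolding split by (simp add: mc w_def)
    show "is_singleton (exponent_set' n k a l \<beta>)"
      unfolding singleton_iff[OF w]
      by (rule is_singleton_reducedI) (use k l1 in \<open>auto simp: w_def\<close>)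
  qed
qed

end
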